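(* Let $R$ be a pseudomeadow and $I,J$ two ideals of $R$. Suppose that $I_{\mathfrak{m}}=J_{\mathfrak{m}}$ for every $\mathfrak{m}\in\mathrm{MaxSpec}(R)$. Then $I=J$.
   Context: A pseudoring is a commutative associative ring that is not required to have a multiplicative identity. A pseudomeadow is a pseudoring $R$ in which every $x\in R$ has a von Neumann inverse, i.e. an element $x^{(-1)}\in R$ (necessarily unique) with $x\,x\,x^{(-1)}=x$ and $x\,x^{(-1)}x^{(-1)}=x^{(-1)}$. An ideal $\mathfrak{m}$ is maximal if $\mathfrak{m}\ne R$ and every ideal $I\supseteq\mathfrak{m}$ satisfies $I=\mathfrak{m}$ or $I=R$; $\mathrm{MaxSpec}(R)$ is the set of maximal ideals. In a pseudomeadow every maximal ideal is prime (proper, and $xy\in\mathfrak{m}$ implies $x\in\mathfrak{m}$ or $y\in\mathfrak{m}$), so $R\setminus\mathfrak{m}$ is non-empty and multiplicatively closed. $R_{\mathfrak{m}}$ is the localization, defined as for rings: fractions $r/s$ with $r\in R$, $s\in R\setminus\mathfrak{m}$, where $r/s=r'/s'$ iff $(rs'-r's)u=0$ for some $u\in R\setminus\mathfrak{m}$, with the usual operations; it is a ring with identity $s/s$. For an ideal $I$ of $R$, $I_{\mathfrak{m}}=\{a/s: a\in I,\ s\in R\setminus\mathfrak{m}\}$, an ideal of $R_{\mathfrak{m}}$. *)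

theory Defs
  imports Main
begin

text \<open>
  A pseudoring is a type of class \<open>comm_ring\<close>, which (unlike \<open>comm_ring_1\<close>) provides
  no multiplicative identity; the ring is the whole type.
\<close>

class pseudomeadow = comm_ring +
  assumes ex_von_neumann_inverse: "\<exists>y. x * x * y = x \<and> x * y * y = y"

definition is_ideal :: "'a::comm_ring set \<Rightarrow> bool" where
  "is_ideal I \<longleftrightarrow> 0 \<in> I \<and> (\<forall>a\<in>I. \<forall>b\<in>I. a - b \<in> I) \<and> (\<forall>r. \<forall>a\<in>I. r * a \<in> I)"

definition is_prime_ideal :: "'a::comm_ring set \<Rightarrow> bool" where
  "is_prime_ideal P \<longleftrightarrow>
     is_ideal P \<and> P \<noteq> UNIV \<and> (\<forall>x y. x * y \<in> P \<longrightarrow> x \<in> P \<or> y \<in> P)"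

definition MaxSpec :: "'a::comm_ring set set" where
  "MaxSpec = {m. is_ideal m \<and> m \<noteq> UNIV \<and>
     (\<forall>I. is_ideal I \<longrightarrow> m \<subseteq> I \<longrightarrow> I = m \<or> I = UNIV)}"

lemma MaxSpec_prime:
  fixes m :: "'a::pseudomeadow set"
  assumes "m \<in> MaxSpec"
  shows "is_prime_ideal m"
proof -
  have m: "is_ideal m" "m \<noteq> UNIV"
    and max: "\<And>I. is_ideal I \<Longrightarrow> m \<subseteq> I \<Longrightarrow> I = m \<or> I = UNIV"
    using assms unfolding MaxSpec_def by auto
  have "x \<in> m" if xy: "x * y \<in> m" and y: "y \<notin> m" for x y
  proof -
    let ?I = "{z. x * z \<in> m}"
    have "is_ideal ?I"
      using m(1) unfolding is_ideal_def by (auto simp: right_diff_distrib mult.left_commute)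
    moreover have "m \<subseteq> ?I"
      using m(1) unfolding is_ideal_def by auto
    ultimately have I: "?I = UNIV"
      using max[of ?I] xy y by blast
    obtain z where z: "x * x * z = x"
      using ex_von_neumann_inverse by blast
    from I have "x * (x * z) \<in> m" by blast
    with z show ?thesis by (simp add: mult.assoc)
  qed
  with m show ?thesis unfolding is_prime_ideal_def by blast
qed

definition frac_rel :: "'a::comm_ring set \<Rightarrow> (('a \<times> 'a) \<times> ('a \<times> 'a)) set" where
  "frac_rel m = {((r, s), (r', s')). s \<notin> m \<and> s' \<notin> m \<and>
     (\<exists>u. u \<notin> m \<and> (r * s' - r' * s) * u = 0)}"

lemma equiv_frac_rel:
  assumes "is_prime_ideal m"
  shows "equiv (UNIV \<times> - m) (frac_rel m)"
proof (rule equivI)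
  have prime: "x \<in> m \<or> y \<in> m" if "x * y \<in> m" for x y
    using assms that unfolding is_prime_ideal_def by blast
  show "frac_rel m \<subseteq> (UNIV \<times> - m) \<times> (UNIV \<times> - m)"
    by (auto simp: frac_rel_def)
  show "refl_on (UNIV \<times> - m) (frac_rel m)"
    by (auto simp: refl_on_def frac_rel_def)
  show "sym (frac_rel m)"
    by (auto simp: sym_def frac_rel_def algebra_simps)
  show "trans (frac_rel m)"
  proof (rule transI, clarsimp simp: frac_rel_def)
    fix r s r' s' r'' s'' u v
    assume s': "s' \<notin> m" and u: "u \<notin> m" "(r * s' - r' * s) * u = 0"
      and v: "v \<notin> m" "(r' * s'' - r'' * s') * v = 0"
    have "(r * s'' - r'' * s) * (s' * (u * v)) =
        ((r * s' - r' * s) * u) * (s'' * v) + ((r' * s'' - r'' * s') * v) * (s * u)"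
      by (simp add: algebra_simps)
    also have "\<dots> = 0" using u v by simp
    finally show "\<exists>w. w \<notin> m \<and> (r * s'' - r'' * s) * w = 0"
      using prime s' u(1) v(1) by blast
  qed
qed

text \<open>The fraction \<open>r/s\<close>, where \<open>s \<notin> m\<close>, as an equivalence class of pairs.\<close>

definition frac :: "'a::comm_ring set \<Rightarrow> 'a \<Rightarrow> 'a \<Rightarrow> ('a \<times> 'a) set" where
  "frac m r s = frac_rel m `` {(r, s)}"

text \<open>Only the underlying set of the localization is defined: comparing two ideals of it
  does not involve its ring operations.\<close>

definition localization :: "'a::comm_ring set \<Rightarrow> ('a \<times> 'a) set set" where
  "localization m = (UNIV \<times> - m) // frac_rel m"

definition local_ideal :: "'a::comm_ring set \<Rightarrow> 'a set \<Rightarrow> ('a \<times> 'a) set set" where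
  "local_ideal m I = {frac m a s |a s. a \<in> I \<and> s \<notin> m}"

lemma frac_eq_iff:
  assumes "is_prime_ideal m" "s \<notin> m" "s' \<notin> m"
  shows "frac m r s = frac m r' s' \<longleftrightarrow> (\<exists>u. u \<notin> m \<and> (r * s' - r' * s) * u = 0)"
proof -
  have "frac m r s = frac m r' s' \<longleftrightarrow> ((r, s), (r', s')) \<in> frac_rel m"
    unfolding frac_def by (rule eq_equiv_class_iff[OF equiv_frac_rel]) (use assms in auto)
  then show ?thesis using assms by (simp add: frac_rel_def)
qed

lemma local_ideal_subset: "local_ideal m I \<subseteq> localization m"
  by (auto simp: local_ideal_def localization_def frac_def quotient_def)

lemma local_ideal_UNIV: "local_ideal m UNIV = localization m"
  by (auto simp: local_ideal_def localization_def frac_def quotient_def)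

end

theory Submission imports Defs begin

text \<open>
  An idempotent \<open>e\<close> outside an ideal \<open>J\<close> can be kept outside some maximal ideal \<open>m\<close> containing \<open>J\<close>:
  an ideal maximal among those containing \<open>J\<close> but not \<open>e\<close> contains every \<open>r - e r\<close>, so any larger
  ideal, containing \<open>e\<close>, is everything. If \<open>x \<in> I - J\<close> has von Neumann inverse \<open>y\<close>, apply this to
  \<open>e = x y\<close>: then \<open>x \<notin> m\<close>, whereas \<open>x/e \<in> J\<^sub>m\<close> would put a product of elements outside \<open>m\<close> into
  \<open>J \<subseteq> m\<close>.
\<close>

lemma is_idealD:
  assumes "is_ideal I"
  shows "0 \<in> I" "\<And>a b. a \<in> I \<Longrightarrow> b \<in> I \<Longrightarrow> a - b \<in> I"
    "\<And>r a. a \<in> I \<Longrightarrow> r * a \<in> I" "\<And>r a. a \<in> I \<Longrightarrow> a * r \<in> I"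
proof -
  show *: "\<And>r a. a \<in> I \<Longrightarrow> r * a \<in> I"
    using assms unfolding is_ideal_def by blast
  show "\<And>r a. a \<in> I \<Longrightarrow> a * r \<in> I"
    by (subst mult.commute) (rule *)
qed (use assms in \<open>simp_all add: is_ideal_def\<close>)

lemma is_ideal_add:
  assumes "is_ideal I" "a \<in> I" "b \<in> I"
  shows "a + b \<in> I"
proof -
  have "a - (0 - b) \<in> I"
    by (intro is_idealD(1,2) assms)
  then show ?thesis by simp
qed

lemma is_ideal_Union_chain:
  assumes "subset.chain A C" "C \<noteq> {}" "\<And>K. K \<in> C \<Longrightarrow> is_ideal K"
  shows "is_ideal (\<Union>C)"
  unfolding is_ideal_def
proof (intro conjI ballI allI)
  show "0 \<in> \<Union>C"
    using assms(2,3) is_idealD(1) by blast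
  show "r * a \<in> \<Union>C" if "a \<in> \<Union>C" for r a
    using that assms(3) is_idealD(3) by blast
  fix a b
  assume "a \<in> \<Union>C" "b \<in> \<Union>C"
  then obtain K L where "K \<in> C" "L \<in> C" "a \<in> K" "b \<in> L" by blast
  moreover from this have "K \<subseteq> L \<or> L \<subseteq> K"
    using assms(1) by (auto simp: subset.chain_def)
  ultimately show "a - b \<in> \<Union>C"
    using assms(3) is_idealD(2) by blast
qed

text \<open>Without an identity, a chain of proper ideals may have the whole ring as its union, so
  Zorn's lemma is applied to the ideals omitting \<open>e\<close>, a condition that does pass to
  unions.\<close>

lemma ex_MaxSpec_avoiding_idempotent:
  fixes e :: "'a::comm_ring"
  assumes J: "is_ideal J" and e: "e * e = e" "e \<notin> J"
  obtains m where "m \<in> MaxSpec" "J \<subseteq> m" "e \<notin> m"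
proof -
  let ?A = "{K. is_ideal K \<and> J \<subseteq> K \<and> e \<notin> K}"
  have "\<exists>m\<in>?A. \<forall>K\<in>?A. m \<subseteq> K \<longrightarrow> K = m"
  proof (rule subset_Zorn_nonempty)
    show "?A \<noteq> {}" using J e(2) by blast
    fix C assume C: "C \<noteq> {}" "subset.chain ?A C"
    then have "C \<subseteq> ?A" by (auto simp: subset.chain_def)
    then show "\<Union>C \<in> ?A"
      using C is_ideal_Union_chain[OF C(2,1)] by blast
  qed
  then obtain m where "m \<in> ?A" and m_max: "\<forall>K\<in>?A. m \<subseteq> K \<longrightarrow> K = m" ..
  then have m: "is_ideal m" "J \<subseteq> m" "e \<notin> m" by simp_all
  have max: "K = m" if "is_ideal K" "m \<subseteq> K" "e \<notin> K" for K
    using m_max m(2) that by simp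
  \<comment> \<open>This ideal omits \<open>e\<close> because \<open>e * e = e\<close>, so
    maximality gives equality; hence everything annihilated by \<open>e\<close> lies in
    \<open>m\<close>.\<close>
  have "{z. e * z \<in> m} = m"
  proof (rule max)
    show "is_ideal {z. e * z \<in> m}"
      using m(1) by (auto simp: is_ideal_def right_diff_distrib mult.left_commute)
    show "m \<subseteq> {z. e * z \<in> m}"
      by (auto intro: is_idealD(3)[OF m(1)])
    show "e \<notin> {z. e * z \<in> m}"
      using e(1) m(3) by simp
  qed
  moreover have "e * (r - e * r) = 0" for r
    using e(1) by (simp add: right_diff_distrib flip: mult.assoc)
  ultimately have complement: "r - e * r \<in> m" for r
    using is_idealD(1)[OF m(1)] by (metis mem_Collect_eq)
  have "K = m \<or> K = UNIV" if K: "is_ideal K" "m \<subseteq> K" for K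
  proof (cases "e \<in> K")
    case True
    have "r \<in> K" for r
    proof -
      have "r - e * r + e * r \<in> K"
        using complement K(2) by (intro is_ideal_add[OF K(1)] is_idealD(4)[OF K(1) True]) blast
      then show ?thesis by simp
    qed
    then show ?thesis by blast
  next
    case False
    then show ?thesis using max K by blast
  qed
  then have "m \<in> MaxSpec"
    using m(1,3) by (auto simp: MaxSpec_def)
  with m that show ?thesis by blast
qed

lemma ideal_subset_if_local_ideal_subset:
  fixes I J :: "'a::pseudomeadow set"
  assumes J: "is_ideal J"
    and local: "\<And>m. m \<in> MaxSpec \<Longrightarrow> local_ideal m I \<subseteq> local_ideal m J"
  shows "I \<subseteq> J"
proof (rule subsetI, rule ccontr)
  fix x assume x: "x \<in> I" "x \<notin> J"
  obtain y where y: "x * x * y = x"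
    using ex_von_neumann_inverse by blast
  define e where "e = x * y"
  have xe: "x * e = x"
    using y by (simp add: e_def mult.assoc)
  have "e * e = x * e * y"
    by (simp add: e_def ac_simps)
  then have "e * e = e"
    by (simp add: xe) (simp add: e_def)
  moreover have "e \<notin> J"
    \<comment> \<open>Otherwise \<open>x = x * e\<close> would lie in \<open>J\<close>.\<close>
    using is_idealD(3)[OF J, of e x] xe x(2) by auto
  ultimately obtain m where m: "m \<in> MaxSpec" "J \<subseteq> m" "e \<notin> m"
    using ex_MaxSpec_avoiding_idempotent[OF J] by blast
  note prime = MaxSpec_prime[OF m(1)]
  \<comment> \<open>\<open>e\<close> is a multiple of \<open>x\<close>, so \<open>x \<in> m\<close>
    would force \<open>e \<in> m\<close>.\<close>
  have "x \<notin> m"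
    using m(3) prime is_idealD(4) by (auto simp: e_def is_prime_ideal_def)
  \<comment> \<open>There is no \<open>x/1\<close> to compare; \<open>e\<close> serves as the
    denominator, being outside \<open>m\<close>.\<close>
  have "frac m x e \<in> local_ideal m J"
    using local[OF m(1)] x(1) m(3) unfolding local_ideal_def by blast
  then obtain a s where a: "a \<in> J" "s \<notin> m" "frac m x e = frac m a s"
    by (auto simp: local_ideal_def)
  then obtain u where u: "u \<notin> m" "(x * s - a * e) * u = 0"
    using frac_eq_iff[OF prime m(3) a(2)] by blast
  \<comment> \<open>The left side is a product of three elements outside the prime ideal
    \<open>m\<close>, the right side a multiple of \<open>a \<in> J\<close>.\<close>
  have "x * s * u = a * (e * u)"
    using u(2) by (simp add: algebra_simps)
  also have "\<dots> \<in> m"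
    by (rule subsetD[OF m(2) is_idealD(4)[OF J a(1)]])
  finally show False
    using prime \<open>x \<notin> m\<close> a(2) u(1) by (auto simp: is_prime_ideal_def)
qed

theorem proposition5p7:
  fixes I J :: "'a::pseudomeadow set"
  assumes "is_ideal I" and "is_ideal J"
    and "\<And>m. m \<in> MaxSpec \<Longrightarrow> local_ideal m I = local_ideal m J"
  shows "I = J"
  using assms by (intro equalityI ideal_subset_if_local_ideal_subset) simp_all

end
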